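(* Let $d\ge1$ and let $\mathbf{r}=(r_0,\ldots,r_{d-1})\in\mathrm{int}(\mathcal{D}_d)$ be reduced, i.e. $r_0\ne0$. Then $\mathbf{r}\in\mathcal{D}_d^{(0)}$ if and only if $$\mathbf{0}\in\mathcal{T}_\mathbf{r}(\mathbf{0})\setminus\bigcup_{\mathbf{y}\in\mathbb{Z}^d,\,\mathbf{y}\ne\mathbf{0}}\mathcal{T}_\mathbf{r}(\mathbf{y}).$$
   Context: For $\mathbf{r}=(r_0,\ldots,r_{d-1})\in\mathbb{R}^d$ and $\mathbf{z}=(z_0,\ldots,z_{d-1})^t\in\mathbb{Z}^d$ put $\mathbf{r}\mathbf{z}=\sum_i r_iz_i$ and $\tau_\mathbf{r}(\mathbf{z})=(z_1,\ldots,z_{d-1},-\lfloor\mathbf{r}\mathbf{z}\rfloor)^t$, a map $\mathbb{Z}^d\to\mathbb{Z}^d$; $\tau_\mathbf{r}^{-n}(\mathbf{x})=\{\mathbf{z}\in\mathbb{Z}^d\mid\tau_\mathbf{r}^n(\mathbf{z})=\mathbf{x}\}$. $\mathcal{D}_d$ is the set of $\mathbf{r}\in\mathbb{R}^d$ such that $(\tau_\mathbf{r}^n(\mathbf{z}))_{n}$ is eventually periodic for all $\mathbf{z}\in\mathbb{Z}^d$; $\mathcal{D}_d^{(0)}$ is the set of $\mathbf{r}\in\mathbb{R}^d$ such that for every $\mathbf{z}\in\mathbb{Z}^d$ there is $n\in\mathbb{N}$ with $\tau_\mathbf{r}^n(\mathbf{z})=\mathbf{0}$. The companion matrix $M_\mathbf{r}\in\mathbb{R}^{d\times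 d}$ has last row $(-r_0,\ldots,-r_{d-1})$, entries $1$ on the superdiagonal of the first $d-1$ rows, and $0$ elsewhere (for $d=1$, $M_\mathbf{r}=(-r_0)$). It is a known fact that $\mathbf{r}\in\mathrm{int}(\mathcal{D}_d)$ if and only if $M_\mathbf{r}$ has spectral radius $<1$. The SRS tile of $\mathbf{x}\in\mathbb{Z}^d$ is $\mathcal{T}_\mathbf{r}(\mathbf{x})=\mathrm{Li}_{n\to\infty}M_\mathbf{r}^n\tau_\mathbf{r}^{-n}(\mathbf{x})$, where the lower Hausdorff limit $\mathrm{Li}_{n\to\infty}A_n$ is the set of all $\mathbf{t}\in\mathbb{R}^d$ such that each neighbourhood of $\mathbf{t}$ intersects $A_n$ for all sufficiently large $n$. *)

theory Defs
  imports "HOL-Analysis.Analysis"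
begin

text \<open>
  The space of \<open>d\<close>-dimensional vectors is \<open>real ^ 'n\<close> (the lattice is \<open>int ^ 'n\<close>) with
  \<open>d = CARD('n)\<close>. The linear order on the finite type \<open>'n\<close> lists the coordinates as
  \<open>0 < 1 < \<dots> < d - 1\<close>; every \<open>d \<ge> 1\<close> occurs, for instance as a numeral type.
\<close>

definition first_index :: "'n::{finite,linorder}" where
  "first_index = Min UNIV"

definition last_index :: "'n::{finite,linorder}" where
  "last_index = Max UNIV"

text \<open>Only meaningful for \<open>i \<noteq> last_index\<close>, where it is the index \<open>i + 1\<close>.\<close>
definition next_index :: "'n::{finite,linorder} \<Rightarrow> 'n" where
  "next_index i = Min {j. i < j}"

definition real_vec :: "int ^ 'n \<Rightarrow> real ^ 'n" where
  "real_vec z = (\<chi> i. of_int (z $ i))"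

definition srs_map :: "real ^ 'n::{finite,linorder} \<Rightarrow> int ^ 'n::_ \<Rightarrow> int ^ 'n::_" where
  "srs_map r z = (\<chi> i. if i = last_index then - \<lfloor>r \<bullet> real_vec z\<rfloor> else z $ next_index i)"

definition eventually_periodic :: "(nat \<Rightarrow> 'a) \<Rightarrow> bool" where
  "eventually_periodic a \<longleftrightarrow> (\<exists>p\<ge>1. \<exists>N. \<forall>n\<ge>N. a (n + p) = a n)"

definition srs_periodic :: "(real ^ 'n::{finite,linorder}) set" where
  "srs_periodic = {r. \<forall>z. eventually_periodic (\<lambda>n. (srs_map r ^^ n) z)}"

definition srs_finite :: "(real ^ 'n::{finite,linorder}) set" where
  "srs_finite = {r. \<forall>z. \<exists>n. (srs_map r ^^ n) z = 0}"

text \<open>For \<open>d = 1\<close> the only index is the last one, so this is the matrix \<open>(- r\<^sub>0)\<close>.\<close>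
definition companion_matrix :: "real ^ 'n::{finite,linorder} \<Rightarrow> real ^ 'n::_ ^ 'n::_" where
  "companion_matrix r =
    (\<chi> i j. if i = last_index then - (r $ j) else if j = next_index i then 1 else 0)"

text \<open>The power \<open>^\<close> on \<open>real ^ 'n ^ 'n\<close> is componentwise, hence this iterated matrix product.\<close>
definition matrix_pow :: "real ^ 'n ^ 'n \<Rightarrow> nat \<Rightarrow> real ^ 'n ^ 'n" where
  "matrix_pow A n = (((**) A) ^^ n) (mat 1)"

definition lower_Hausdorff_limit :: "(nat \<Rightarrow> 'a::topological_space set) \<Rightarrow> 'a set" where
  "lower_Hausdorff_limit A =
    {t. \<forall>U. open U \<and> t \<in> U \<longrightarrow> (\<forall>\<^sub>F n in sequentially. U \<inter> A n \<noteq> {})}"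

definition srs_tile :: "real ^ 'n::{finite,linorder} \<Rightarrow> int ^ 'n::_ \<Rightarrow> (real ^ 'n::_) set" where
  "srs_tile r x = lower_Hausdorff_limit
    (\<lambda>n. (\<lambda>z. matrix_pow (companion_matrix r) n *v real_vec z) ` {z. (srs_map r ^^ n) z = x})"

end

theory Submission
  imports Defs "HOL-Computational_Algebra.Fundamental_Theorem_Algebra"
begin

text \<open>
  Reading off first coordinates turns orbits of \<open>srs_map r\<close> and of the companion matrix into
  scalar sequences that satisfy, up to an error in \<open>[0, 1)\<close> respectively exactly, the linear
  recurrence with characteristic polynomial \<open>p = x\<^sup>d + r\<^bsub>d-1\<^esub> x\<^bsup>d-1\<^esup> + \<dots> + r\<^sub>0\<close>.
  A root of \<open>p\<close> outside the closed unit disc gives an unbounded orbit. Replacing \<open>r\<^sub>i\<close> by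
  \<open>c\<^bsup>d-i\<^esup> r\<^sub>i\<close> multiplies all roots by \<open>c\<close>, so for \<open>r\<close> in the interior of \<open>srs_periodic\<close> all roots
  lie in a disc of radius less than 1, and powers of the companion matrix decay geometrically.

  Under this contraction \<open>0 \<in> srs_tile r x\<close> holds exactly if \<open>x\<close> is a purely periodic point:
  for \<open>z\<close> with \<open>\<tau>\<^sup>n z = x\<close> and \<open>M\<^sup>n z\<close> small, the points \<open>\<tau>\<^bsup>n-j\<^esup> z\<close>, for \<open>j\<close> up to any prescribed
  bound, lie in a fixed finite set (here \<open>M\<close> has to be invertible), so two of them coincide. Finally,
  since all orbits are eventually periodic, they all reach 0 iff 0 is the only purely periodic point.
\<close>

section \<open>Coordinate positions\<close>

text \<open>Turns the abstract index type into the exponents 0, ..., d - 1, so that coordinates can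
  be matched with powers of the variable and with time shifts.\<close>

definition pos :: "'n::{finite,linorder} \<Rightarrow> nat" where
  "pos i = card {j. j < i}"

lemma pos_less_iff: "pos (i::'n::{finite,linorder}) < pos j \<longleftrightarrow> i < j"
proof -
  have *: "pos a < pos b" if "a < b" for a b :: 'n
    unfolding pos_def by (rule psubset_card_mono) (use that in auto)
  show ?thesis
    using *[of i j] *[of j i] by (cases i j rule: linorder_cases) auto
qed

lemma pos_eq_iff: "pos (i::'n::{finite,linorder}) = pos j \<longleftrightarrow> i = j"
  using pos_less_iff[of i j] pos_less_iff[of j i] by (auto simp: neq_iff)

lemma pos_less_card: "pos (i::'n::{finite,linorder}) < CARD('n)"
  unfolding pos_def by (rule psubset_card_mono) auto

lemma bij_betw_pos: "bij_betw pos (UNIV::'n::{finite,linorder} set) {..<CARD('n)}"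
  unfolding bij_betw_def
proof
  show inj: "inj (pos :: 'n \<Rightarrow> nat)"
    by (auto simp: inj_on_def pos_eq_iff)
  show "range (pos :: 'n \<Rightarrow> nat) = {..<CARD('n)}"
    by (rule card_subset_eq) (auto simp: pos_less_card card_image inj)
qed

lemma obtain_pos:
  assumes "k < CARD('n)"
  obtains i :: "'n::{finite,linorder}" where "pos i = k"
  using bij_betw_pos[where 'n='n] assms unfolding bij_betw_def by (metis imageE lessThan_iff)

lemma pos_first_index: "pos (first_index::'n::{finite,linorder}) = 0"
proof -
  have "first_index \<le> j" for j :: 'n
    unfolding first_index_def by (rule Min_le) auto
  then show ?thesis by (simp add: pos_def leD)
qed

lemma Suc_pos_last_index: "Suc (pos (last_index::'n::{finite,linorder})) = CARD('n)"
proof -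
  have "j \<le> last_index" for j :: 'n
    unfolding last_index_def by simp
  then have "{j. j < (last_index::'n)} = UNIV - {last_index}"
    by (auto simp: order_less_le)
  then show ?thesis
    by (simp add: pos_def card_Diff_singleton)
qed

lemma pos_next_index:
  fixes i :: "'n::{finite,linorder}"
  assumes "i \<noteq> last_index"
  shows "pos (next_index i) = Suc (pos i)"
proof -
  have "i \<le> last_index"
    unfolding last_index_def by simp
  with assms have ne: "{j. i < j} \<noteq> {}"
    by (auto simp: order_less_le)
  then have gt: "i < next_index i"
    unfolding next_index_def using Min_in[OF _ ne] by simp
  have "next_index i \<le> j" if "i < j" for j
    unfolding next_index_def using that by (simp add: Min_le)
  then have "j < next_index i \<longleftrightarrow> j = i \<or> j < i" for j
    using gt by (meson leD le_less_trans le_less linorder_le_less_linear)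
  then have "{j. j < next_index i} = insert i {j. j < i}"
    by blast
  then show ?thesis
    by (simp add: pos_def)
qed

text \<open>Each application of \<open>f\<close> moves every entry one position towards the front,
  so the entry at position k is first after k more steps. Only this shift is assumed, which covers
  both \<open>srs_map r\<close> and the companion matrix.\<close>

lemma orbit_component:
  fixes f :: "'a ^ 'n::{finite,linorder} \<Rightarrow> 'a ^ 'n::_"
  assumes f: "\<And>z i. i \<noteq> last_index \<Longrightarrow> f z $ i = z $ next_index i"
  shows "(f ^^ n) z $ i = (f ^^ (n + pos i)) z $ first_index"
proof -
  have "z $ i = (f ^^ k) z $ first_index" if "pos i = k" for k z and i :: 'n
    using that
  proof (induction k arbitrary: i z)
    case 0
    then have "i = first_index"
      using pos_eq_iff pos_first_index by metis
    then show ?case by simp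
  next
    case (Suc k)
    then have lt: "Suc k < CARD('n)"
      using pos_less_card[of i] by simp
    then obtain j :: 'n where j: "pos j = k"
      using obtain_pos Suc_lessD by blast
    then have nl: "j \<noteq> last_index"
      using Suc_pos_last_index[where 'n='n] lt by auto
    have "next_index j = i"
      using pos_next_index[OF nl] j Suc.prems pos_eq_iff by metis
    then have "z $ i = f z $ j"
      using f[OF nl] by simp
    also have "\<dots> = (f ^^ Suc k) z $ first_index"
      using Suc.IH[OF j] by (simp add: funpow_swap1)
    finally show ?case .
  qed
  from this[OF refl, where i = i and z = "(f ^^ n) z"] show ?thesis
    by (simp add: funpow_add add.commute[of n])
qed

section \<open>Linear recurrences\<close>

text \<open>The action of p(S) on sequences, S being the shift operator: factoring a polynomial
  factors the recurrence.\<close>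

definition shift_poly :: "'a::comm_ring_1 poly \<Rightarrow> (nat \<Rightarrow> 'a) \<Rightarrow> nat \<Rightarrow> 'a" where
  "shift_poly p u n = (\<Sum>i\<le>degree p. coeff p i * u (n + i))"

lemma shift_poly_eq:
  assumes "degree p \<le> N"
  shows "shift_poly p u n = (\<Sum>i\<le>N. coeff p i * u (n + i))"
  unfolding shift_poly_def using assms
  by (intro sum.mono_neutral_left) (auto simp: coeff_eq_0)

lemma shift_poly_add: "shift_poly (p + q) u n = shift_poly p u n + shift_poly q u n"
proof -
  let ?N = "max (degree p) (degree q)"
  have "degree (p + q) \<le> ?N" by (rule degree_add_le_max)
  then show ?thesis
    using shift_poly_eq[of p ?N u n] shift_poly_eq[of q ?N u n] shift_poly_eq[of "p + q" ?N u n]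
    by (simp add: ring_distribs sum.distrib)
qed

lemma shift_poly_0: "shift_poly 0 u n = 0"
  by (simp add: shift_poly_def)

lemma shift_poly_monom: "shift_poly (monom c k) u n = c * u (n + k)"
  by (subst shift_poly_eq[of _ k]) (auto simp: degree_monom_le if_distrib[of "\<lambda>x. x * _"] cong: if_cong)

lemma shift_poly_sum: "shift_poly (\<Sum>i\<in>A. p i) u n = (\<Sum>i\<in>A. shift_poly (p i) u n)"
  by (induction A rule: infinite_finite_induct) (simp_all add: shift_poly_add shift_poly_0)

text \<open>The variable acts as the shift, so x - c acts as a first-order difference operator. This
  allows roots to be split off one at a time.\<close>

lemma shift_poly_linear_factor:
  "shift_poly ([:-c, 1:] * q) u n = shift_poly q u (Suc n) - c * shift_poly q u n"
proof -
  let ?N = "Suc (degree q)"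
  have 1: "shift_poly (pCons 0 q) u n = shift_poly q u (Suc n)"
    by (subst shift_poly_eq[of _ ?N]) (auto simp: degree_pCons_le sum.atMost_Suc_shift shift_poly_def simp del: sum.atMost_Suc)
  have 2: "shift_poly (smult (-c) q) u n = - c * shift_poly q u n"
    by (subst shift_poly_eq[of _ "degree q"])
      (auto simp: degree_smult_le shift_poly_def sum_distrib_left sum_negf mult.assoc)
  have "[:-c, 1:] * q = smult (-c) q + pCons 0 q" by simp
  then show ?thesis
    by (simp only: shift_poly_add 1 2) simp
qed

lemma first_order_geometric_bound:
  fixes w :: "nat \<Rightarrow> complex"
  assumes "norm c < \<rho>" and "\<And>n. norm (w (Suc n) - c * w n) \<le> C * \<rho> ^ n"
  shows "\<exists>D. \<forall>n. norm (w n) \<le> D * \<rho> ^ n"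
proof -
  \<comment> \<open>The first entry starts the induction; the second gives C + |c| D \<le> \<rho> D,
    which carries it on.\<close>
  define D where "D = max (norm (w 0)) (C / (\<rho> - norm c))"
  have pos: "0 < \<rho>" using assms(1) norm_ge_zero[of c] by linarith
  have CD: "C \<le> D * (\<rho> - norm c)"
    using assms(1) by (simp add: D_def pos_divide_le_eq[symmetric])
  have "norm (w n) \<le> D * \<rho> ^ n" for n
  proof (induction n)
    case 0
    show ?case by (simp add: D_def)
  next
    case (Suc n)
    have "norm (w (Suc n)) \<le> norm c * norm (w n) + norm (w (Suc n) - c * w n)"
      using norm_triangle_ineq[of "c * w n" "w (Suc n) - c * w n"] by (simp add: norm_mult)
    also have "\<dots> \<le> norm c * (D * \<rho> ^ n) + C * \<rho> ^ n"
      using Suc assms(2) by (intro add_mono mult_left_mono) auto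
    also have "\<dots> \<le> norm c * (D * \<rho> ^ n) + (D * (\<rho> - norm c)) * \<rho> ^ n"
      using CD pos by (intro add_left_mono mult_right_mono) auto
    also have "\<dots> = D * \<rho> ^ Suc n" by (simp add: algebra_simps)
    finally show ?case .
  qed
  then show ?thesis by blast
qed

text \<open>Induction on the degree: with p = (x - z) q, the sequence \<open>shift_poly q u\<close>
  solves a first-order recurrence with geometric error, hence is itself geometrically bounded, and q
  takes the place of p with a new constant.\<close>

lemma linear_recurrence_geometric_bound:
  fixes p :: "complex poly"
  assumes "p \<noteq> 0" and "\<And>z. poly p z = 0 \<Longrightarrow> norm z < \<rho>"
    and "\<And>n. norm (shift_poly p u n) \<le> C * \<rho> ^ n"
  shows "\<exists>D. \<forall>n. norm (u n) \<le> D * \<rho> ^ n"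
  using assms
proof (induction "degree p" arbitrary: p C)
  case 0
  then obtain c where p: "p = [:c:]" using degree_eq_zeroE by metis
  with 0 have "c \<noteq> 0" by auto
  have "norm (u n) \<le> C / norm c * \<rho> ^ n" for n
    using "0.prems"(3)[of n] \<open>c \<noteq> 0\<close> by (simp add: p shift_poly_def norm_mult field_simps)
  then show ?case by blast
next
  case (Suc k)
  then have "\<not> constant (poly p)" by (simp add: constant_degree)
  then obtain z where z: "poly p z = 0"
    using fundamental_theorem_of_algebra by blast
  then obtain q where q: "p = [:-z, 1:] * q"
    by (metis dvdE poly_eq_0_iff_dvd)
  with Suc.prems(1) have "q \<noteq> 0" by auto
  then have "degree p = Suc (degree q)"
    unfolding q by (subst degree_mult_eq) auto
  then have k: "k = degree q" using Suc.hyps(2) by simp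
  have "norm (shift_poly q u (Suc n) - z * shift_poly q u n) \<le> C * \<rho> ^ n" for n
    using Suc.prems(3)[of n] unfolding q shift_poly_linear_factor .
  with first_order_geometric_bound[OF Suc.prems(2)[OF z]]
  obtain D where "\<And>n. norm (shift_poly q u n) \<le> D * \<rho> ^ n" by blast
  moreover have "norm x < \<rho>" if "poly q x = 0" for x
    using that by (intro Suc.prems(2)) (simp add: q)
  ultimately show ?case
    using Suc.hyps(1)[OF k \<open>q \<noteq> 0\<close>] by blast
qed

section \<open>The characteristic polynomial\<close>

text \<open>The characteristic polynomial of the companion matrix, taken over the complex numbers so
  that roots can be split off.\<close>

definition srs_poly :: "real ^ 'n::{finite,linorder} \<Rightarrow> complex poly" where
  "srs_poly r = monom 1 CARD('n) + (\<Sum>i\<in>UNIV. monom (of_real (r $ i)) (pos i))"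

lemma shift_poly_srs_poly:
  fixes r :: "real ^ 'n::{finite,linorder}"
  shows "shift_poly (srs_poly r) u n
    = u (n + CARD('n)) + (\<Sum>i\<in>UNIV. of_real (r $ i) * u (n + pos i))"
  by (simp add: srs_poly_def shift_poly_add shift_poly_sum shift_poly_monom)

lemma
  fixes r :: "real ^ 'n::{finite,linorder}"
  shows degree_srs_poly: "degree (srs_poly r) = CARD('n)"
    and lead_coeff_srs_poly: "lead_coeff (srs_poly r) = 1"
proof -
  have *: "degree (\<Sum>i\<in>(UNIV::'n set). monom (complex_of_real (r $ i)) (pos i)) < CARD('n)"
    by (rule degree_sum_less) (auto intro: le_less_trans[OF degree_monom_le pos_less_card])
  then show deg: "degree (srs_poly r) = CARD('n)"
    unfolding srs_poly_def by (subst degree_add_eq_left) (auto simp: degree_monom_eq)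
  show "lead_coeff (srs_poly r) = 1"
    unfolding deg using * by (simp add: srs_poly_def coeff_eq_0)
qed

text \<open>The coefficient of index k contributes c^(d-k) and the argument c^k, so every term gains
  the same factor c^d.\<close>

lemma poly_srs_poly_scale:
  fixes r :: "real ^ 'n::{finite,linorder}"
  shows "poly (srs_poly (\<chi> i. c ^ (CARD('n) - pos i) * r $ i)) (of_real c * x)
    = of_real c ^ CARD('n) * poly (srs_poly r) x"
proof -
  have "of_real (c ^ (CARD('n) - pos i) * r $ i) * (of_real c ^ pos i * x ^ pos i)
     = of_real c ^ CARD('n) * (of_real (r $ i) * x ^ pos i)" for i :: 'n
  proof -
    have "(of_real c :: complex) ^ (CARD('n) - pos i) * of_real c ^ pos i = of_real c ^ CARD('n)"
      using pos_less_card[of i] by (simp add: power_add[symmetric])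
    then show ?thesis by (simp add: power_mult_distrib algebra_simps)
  qed
  then show ?thesis
    unfolding srs_poly_def
    by (simp only: poly_add poly_sum poly_monom vec_lambda_beta distrib_left sum_distrib_left
        power_mult_distrib mult_1_left)
qed

lemma inner_real_vec: "r \<bullet> real_vec z = (\<Sum>i\<in>UNIV. r $ i * of_int (z $ i))"
  by (simp add: inner_vec_def real_vec_def)

text \<open>Write the polynomial as (x - root) q. Applying q(S) to the first coordinates of an orbit
  gives w with w(n+1) = root * w(n) + error, the error lying in [0, 1). If the root has norm above 1
  and w starts large enough, |w| grows strictly, which rules out periodicity.\<close>

lemma root_norm_le_1_if_srs_periodic:
  fixes r :: "real ^ 'n::{finite,linorder}"
  assumes r: "r \<in> srs_periodic" and root: "poly (srs_poly r) x = 0"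
  shows "norm x \<le> 1"
proof (rule ccontr)
  assume "\<not> norm x \<le> 1"
  then have x: "norm x > 1" by simp
  let ?d = "CARD('n)"
  obtain q where q: "srs_poly r = [:-x, 1:] * q"
    using root by (metis dvdE poly_eq_0_iff_dvd)
  have "q \<noteq> 0"
    using q lead_coeff_srs_poly[of r] by auto
  then have "degree (srs_poly r) = Suc (degree q)"
    unfolding q by (subst degree_mult_eq) auto
  then have degq: "?d = Suc (degree q)" by (simp add: degree_srs_poly)
  have "lead_coeff q = 1"
    using lead_coeff_srs_poly[of r] unfolding q lead_coeff_mult by simp
  \<comment> \<open>Above this threshold the expansion by |x| outweighs an error of size 1.\<close>
  obtain K :: nat where K: "real K > 1 / (norm x - 1)"
    using reals_Archimedean2 by blast
  \<comment> \<open>With only the last entry nonzero, w(0) sees only the leading coefficient of q,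
    which is 1; the other coefficients cannot interfere.\<close>
  define z :: "int ^ 'n::_" where "z = (\<chi> i. if i = last_index then int K else 0)"
  define a where "a n = (srs_map r ^^ n) z $ first_index" for n
  have comp: "(srs_map r ^^ n) z $ i = a (n + pos i)" for n i
    unfolding a_def by (rule orbit_component) (simp add: srs_map_def)
  define w where "w = shift_poly q (\<lambda>n. of_int (a n))"
  have step: "norm (w (Suc n) - x * w n) \<le> 1" for n
  proof -
    let ?y = "(srs_map r ^^ n) z"
    \<comment> \<open>The last coordinate has position d - 1, so the entry created by the next step
      is term n + d.\<close>
    have "a (n + ?d) = (srs_map r ^^ Suc n) z $ last_index"
      unfolding comp by (simp add: Suc_pos_last_index[symmetric, where 'n='n])
    also have "\<dots> = - \<lfloor>r \<bullet> real_vec ?y\<rfloor>" by (simp add: srs_map_def)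
    finally have an: "a (n + ?d) = - \<lfloor>r \<bullet> real_vec ?y\<rfloor>" .
    have "w (Suc n) - x * w n = shift_poly (srs_poly r) (\<lambda>n. of_int (a n)) n"
      unfolding w_def q shift_poly_linear_factor ..
    also have "\<dots> = of_real (of_int (a (n + ?d)) + (\<Sum>i\<in>UNIV. r $ i * of_int (a (n + pos i))))"
      unfolding shift_poly_srs_poly by simp
    also have "\<dots> = of_real (frac (r \<bullet> real_vec ?y))"
      unfolding an by (simp add: inner_real_vec comp frac_def)
    finally show ?thesis
      using frac_lt_1[of "r \<bullet> real_vec ?y"] by simp
  qed
  have w0: "w 0 = of_nat K"
  proof -
    have "w 0 = (\<Sum>i<?d. coeff q i * of_int (a i))"
      unfolding w_def shift_poly_def degq by (simp add: lessThan_Suc_atMost)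
    also have "\<dots> = (\<Sum>j\<in>(UNIV::'n set). coeff q (pos j) * of_int (a (pos j)))"
      by (rule sum.reindex_bij_betw[OF bij_betw_pos, symmetric])
    also have "\<dots> = (\<Sum>j\<in>(UNIV::'n set). if j = last_index then coeff q (pos (last_index::'n)) * of_nat K else 0)"
      by (rule sum.cong) (auto simp: comp[of 0, simplified, symmetric] z_def)
    also have "\<dots> = coeff q (degree q) * of_nat K"
      using degq Suc_pos_last_index[where 'n='n] by simp
    finally show ?thesis using \<open>lead_coeff q = 1\<close> by simp
  qed
  have grow: "norm (w n) < norm (w (Suc n))" if "norm (w n) > 1 / (norm x - 1)" for n
  proof -
    have "1 < norm (w n) * (norm x - 1)"
      using that x by (simp add: pos_divide_less_eq)
    moreover have "norm (x * w n) \<le> norm (w (Suc n)) + norm (w (Suc n) - x * w n)"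
      using norm_triangle_ineq4[of "w (Suc n)" "w (Suc n) - x * w n"] by simp
    ultimately show ?thesis
      using step[of n] by (simp add: norm_mult algebra_simps)
  qed
  have big: "norm (w n) > 1 / (norm x - 1)" for n
    by (induction n) (use K w0 grow in \<open>force+\<close>)
  have mono: "strict_mono (\<lambda>n. norm (w n))"
    by (rule strict_monoI_Suc) (simp add: grow big)
  obtain m N where m: "m \<ge> 1" "\<And>n. n \<ge> N \<Longrightarrow> (srs_map r ^^ (n + m)) z = (srs_map r ^^ n) z"
    using r unfolding srs_periodic_def eventually_periodic_def by blast
  \<comment> \<open>w(n) depends only on the terms of \<open>a\<close> from n on, so it inherits the
    period.\<close>
  have "a (N + m + i) = a (N + i)" for i
    using m(2)[of "N + i"] unfolding a_def by (simp add: ac_simps)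
  then have "w (N + m) = w N"
    unfolding w_def shift_poly_def by simp
  moreover have "norm (w N) < norm (w (N + m))"
    using strict_monoD[OF mono, of N "N + m"] m(1) by simp
  ultimately show False by simp
qed

text \<open>Openness leaves room to stretch all roots by some c > 1 and remain periodic; the
  stretched roots have norm at most 1, so the original ones have norm at most 1 / c.\<close>

lemma roots_in_smaller_disc:
  fixes r :: "real ^ 'n::{finite,linorder}"
  assumes "r \<in> interior srs_periodic"
  obtains \<rho> where "0 < \<rho>" "\<rho> < 1" "\<And>x. poly (srs_poly r) x = 0 \<Longrightarrow> norm x < \<rho>"
proof -
  define s :: "real \<Rightarrow> real ^ 'n::_" where "s c = (\<chi> i. c ^ (CARD('n) - pos i) * r $ i)" for c
  have "s 1 = r" by (simp add: s_def vec_eq_iff)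
  have "(s \<longlongrightarrow> s 1) (at_right 1)"
    unfolding s_def by (intro tendsto_vec_lambda tendsto_intros)
  then have "\<forall>\<^sub>F c in at_right 1. s c \<in> interior srs_periodic"
    using assms topological_tendstoD[OF _ open_interior] \<open>s 1 = r\<close> by metis
  moreover have "\<forall>\<^sub>F c in at_right 1. (1::real) < c"
    by (simp add: eventually_at_right_less)
  ultimately have "\<forall>\<^sub>F c in at_right 1. s c \<in> interior srs_periodic \<and> 1 < c"
    by (rule eventually_conj)
  then obtain c where c: "s c \<in> interior srs_periodic" "1 < c"
    using eventually_happens' trivial_limit_at_right_real by blast
  \<comment> \<open>Strictly above 1 / c, to turn the weak bound on the roots into a strict
    one.\<close>
  obtain \<rho> where \<rho>: "1 / c < \<rho>" "\<rho> < 1"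
    using dense[of "1 / c" 1] c(2) by auto
  show ?thesis
  proof (rule that)
    show "\<rho> < 1" by fact
    show "0 < \<rho>" using \<rho>(1) c(2) by (smt (verit) divide_pos_pos)
    fix x assume "poly (srs_poly r) x = 0"
    then have "poly (srs_poly (s c)) (of_real c * x) = 0"
      unfolding s_def poly_srs_poly_scale by simp
    then have "norm (of_real c * x) \<le> 1"
      using root_norm_le_1_if_srs_periodic c(1) interior_subset by blast
    then have "norm x \<le> 1 / c"
      using c(2) by (simp add: norm_mult field_simps)
    then show "norm x < \<rho>" using \<rho>(1) by simp
  qed
qed

section \<open>The companion matrix\<close>

lemma matrix_pow_vector: "matrix_pow A n *v x = (((*v) A) ^^ n) x"
  by (induction n) (simp_all add: matrix_pow_def matrix_vector_mul_assoc[symmetric])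

lemma companion_matrix_vector:
  fixes r v :: "real ^ 'n::{finite,linorder}"
  shows "(companion_matrix r *v v) $ i = (if i = last_index then - (r \<bullet> v) else v $ next_index i)"
proof -
  have "(\<Sum>j\<in>UNIV. (if j = next_index i then 1 else 0) * v $ j) = v $ next_index i"
    by (subst sum.remove[of _ "next_index i"]) auto
  then show ?thesis
    by (simp add: companion_matrix_def matrix_vector_mult_def inner_vec_def sum_negf)
qed

text \<open>The first coordinates satisfy the recurrence of \<open>srs_poly r\<close> exactly, so
  the recurrence bound applies with error constant 0. The other coordinates are later terms of the
  same sequence, and \<rho> < 1 makes their bounds only smaller.\<close>

lemma companion_matrix_orbit_bound:
  fixes r v :: "real ^ 'n::{finite,linorder}"
  assumes "0 < \<rho>" "\<rho> < 1" and "\<And>x. poly (srs_poly r) x = 0 \<Longrightarrow> norm x < \<rho>"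
  shows "\<exists>D. \<forall>n. norm ((((*v) (companion_matrix r)) ^^ n) v) \<le> D * \<rho> ^ n"
proof -
  let ?M = "(*v) (companion_matrix r)" and ?d = "CARD('n)"
  define u where "u n = (?M ^^ n) v $ first_index" for n
  have comp: "(?M ^^ n) v $ i = u (n + pos i)" for n i
    unfolding u_def by (rule orbit_component) (simp add: companion_matrix_vector)
  have "shift_poly (srs_poly r) (\<lambda>n. of_real (u n)) n = 0" for n
  proof -
    have "u (n + ?d) = (?M ^^ Suc n) v $ last_index"
      unfolding comp by (simp add: Suc_pos_last_index[symmetric, where 'n='n])
    also have "\<dots> = - (\<Sum>i\<in>UNIV. r $ i * u (n + pos i))"
      by (simp add: companion_matrix_vector inner_vec_def comp)
    finally show ?thesis
      unfolding shift_poly_srs_poly by simp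
  qed
  then have "\<exists>D. \<forall>n. norm (complex_of_real (u n)) \<le> D * \<rho> ^ n"
    using lead_coeff_srs_poly[of r] assms(3)
    by (intro linear_recurrence_geometric_bound[of "srs_poly r" _ _ 0]) auto
  then obtain D where D: "\<And>n. \<bar>u n\<bar> \<le> D * \<rho> ^ n" by auto
  have "norm ((?M ^^ n) v) \<le> (of_nat ?d * D) * \<rho> ^ n" for n
  proof -
    have "norm ((?M ^^ n) v) \<le> (\<Sum>i\<in>UNIV. norm ((?M ^^ n) v $ i))"
      by (simp add: norm_le_l1_cart)
    also have "\<dots> \<le> (\<Sum>i\<in>(UNIV::'n set). D * \<rho> ^ n)"
    proof (rule sum_mono)
      fix i :: 'n
      have "0 \<le> D" using D[of 0] by simp
      have "norm ((?M ^^ n) v $ i) \<le> D * \<rho> ^ (n + pos i)"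
        using D unfolding comp by simp
      also have "\<dots> \<le> D * \<rho> ^ n"
        using assms(1,2) \<open>0 \<le> D\<close> by (intro mult_left_mono power_decreasing) auto
      finally show "norm ((?M ^^ n) v $ i) \<le> D * \<rho> ^ n" .
    qed
    finally show ?thesis by (simp add: algebra_simps)
  qed
  then show ?thesis by blast
qed

text \<open>On the kernel the shift rows kill every coordinate except the first, and the last row
  then reads r_0 v_0 = 0.\<close>

lemma inj_companion_matrix:
  fixes r :: "real ^ 'n::{finite,linorder}"
  assumes "r $ first_index \<noteq> 0"
  shows "inj ((*v) (companion_matrix r))"
proof -
  have "v = 0" if v: "companion_matrix r *v v = 0" for v
  proof -
    have nz: "v $ i = 0" if "i \<noteq> first_index" for i
    proof -
      have "pos i \<noteq> 0" using that pos_eq_iff pos_first_index by metis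
      then obtain k where k: "pos i = Suc k" using not0_implies_Suc by blast
      obtain j :: 'n where j: "pos j = k"
        using obtain_pos k pos_less_card[of i] Suc_lessD by metis
      then have nl: "j \<noteq> last_index"
        using Suc_pos_last_index[where 'n='n] k pos_less_card[of i] by auto
      then have "next_index j = i"
        using pos_next_index[OF nl] j k pos_eq_iff by metis
      then show ?thesis
        using companion_matrix_vector[of r v j] v nl by simp
    qed
    have "r \<bullet> v = 0"
      using companion_matrix_vector[of r v last_index] v by simp
    moreover have "r \<bullet> v = r $ first_index * v $ first_index"
      unfolding inner_vec_def by (subst sum.remove[of _ first_index]) (auto simp: nz)
    ultimately have "v $ first_index = 0" using assms by simp
    with nz show ?thesis by (auto simp: vec_eq_iff) metis
  qed
  then show ?thesis
    by (simp add: linear_injective_0)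
qed

section \<open>Lattice orbits as linear orbits with bounded error\<close>

lemma real_vec_srs_map:
  fixes r :: "real ^ 'n::{finite,linorder}"
  shows "real_vec (srs_map r z)
    = companion_matrix r *v real_vec z + frac (r \<bullet> real_vec z) *\<^sub>R axis last_index 1"
  by (auto simp: vec_eq_iff companion_matrix_vector real_vec_def srs_map_def axis_def frac_def)

lemma real_vec_srs_map_funpow:
  fixes r :: "real ^ 'n::{finite,linorder}"
  shows "real_vec ((srs_map r ^^ n) z) = (((*v) (companion_matrix r)) ^^ n) (real_vec z)
    + (\<Sum>j<n. frac (r \<bullet> real_vec ((srs_map r ^^ (n - Suc j)) z)) *\<^sub>R
        (((*v) (companion_matrix r)) ^^ j) (axis last_index 1))"
proof (induction n)
  case (Suc n)
  \<comment> \<open>Splitting off j = 0 isolates the newest rounding error; the remaining terms are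
    the matrix applied to the sum for n.\<close>
  show ?case
    unfolding sum.lessThan_Suc_shift
    by (simp add: real_vec_srs_map Suc matrix_vector_right_distrib linear_sum
        matrix_vector_mult_scaleR algebra_simps)
qed simp

text \<open>All rounding errors are multiples, by factors in [0, 1), of one basis vector. A single
  decay constant for the orbit of that vector therefore bounds their total by a geometric series,
  uniformly in n and z.\<close>

lemma srs_orbit_bound:
  fixes r :: "real ^ 'n::{finite,linorder}"
  assumes "0 < \<rho>" "\<rho> < 1" and "\<And>x. poly (srs_poly r) x = 0 \<Longrightarrow> norm x < \<rho>"
  obtains C where "\<And>n z. norm (real_vec ((srs_map r ^^ n) z))
    \<le> norm ((((*v) (companion_matrix r)) ^^ n) (real_vec z)) + C"
proof -
  let ?M = "(*v) (companion_matrix r)"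
  obtain D where D: "\<And>n. norm ((?M ^^ n) (axis last_index 1)) \<le> D * \<rho> ^ n"
    using companion_matrix_orbit_bound[OF assms] by blast
  have "0 \<le> D" using D[of 0] norm_ge_zero order_trans by fastforce
  show ?thesis
  proof (rule that)
    fix n z
    let ?e = "\<lambda>j. frac (r \<bullet> real_vec ((srs_map r ^^ (n - Suc j)) z)) *\<^sub>R (?M ^^ j) (axis last_index 1)"
    have "norm (\<Sum>j<n. ?e j) \<le> (\<Sum>j<n. norm (?e j))"
      by (rule norm_sum)
    also have "\<dots> \<le> (\<Sum>j<n. D * \<rho> ^ j)"
    proof (rule sum_mono)
      fix j
      have "norm (?e j) \<le> 1 * norm ((?M ^^ j) (axis last_index 1))"
        unfolding norm_scaleR
        by (intro mult_right_mono) (use frac_lt_1 less_imp_le in auto)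
      then show "norm (?e j) \<le> D * \<rho> ^ j" using D[of j] by simp
    qed
    also have "\<dots> \<le> D * (1 / (1 - \<rho>))"
      unfolding sum_distrib_left[symmetric] using assms(1,2) \<open>0 \<le> D\<close>
      by (intro mult_left_mono) (auto simp: sum_gp_strict divide_right_mono)
    finally have "norm ((?M ^^ n) (real_vec z) + (\<Sum>j<n. ?e j))
      \<le> norm ((?M ^^ n) (real_vec z)) + D * (1 / (1 - \<rho>))"
      by (rule norm_triangle_le[OF add_left_mono])
    then show "norm (real_vec ((srs_map r ^^ n) z))
      \<le> norm ((?M ^^ n) (real_vec z)) + D * (1 / (1 - \<rho>))"
      unfolding real_vec_srs_map_funpow[where n = n and z = z] .
  qed
qed

lemma finite_lattice_ball: "finite {z :: int ^ 'n. norm (real_vec z) \<le> R}"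
proof (rule finite_subset)
  show "{z :: int ^ 'n. norm (real_vec z) \<le> R} \<subseteq> vec_lambda ` (UNIV \<rightarrow>\<^sub>E {-\<lceil>R\<rceil>..\<lceil>R\<rceil>})"
  proof
    fix z :: "int ^ 'n" assume z: "z \<in> {z. norm (real_vec z) \<le> R}"
    have "\<bar>z $ i\<bar> \<le> \<lceil>R\<rceil>" for i
    proof -
      have "\<bar>real_of_int (z $ i)\<bar> \<le> R"
        using component_le_norm_cart[of "real_vec z" i] z by (simp add: real_vec_def)
      then show ?thesis by linarith
    qed
    then have "vec_nth z \<in> UNIV \<rightarrow>\<^sub>E {-\<lceil>R\<rceil>..\<lceil>R\<rceil>}"
      by (auto simp: abs_le_iff minus_le_iff)
    then show "z \<in> vec_lambda ` (UNIV \<rightarrow>\<^sub>E {-\<lceil>R\<rceil>..\<lceil>R\<rceil>})"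
      by (metis image_eqI vec_nth_inverse)
  qed
qed (simp add: finite_PiE)

section \<open>Purely periodic points\<close>

lemma funpow_mult_fixed:
  assumes "(f ^^ m) x = x"
  shows "(f ^^ (m * n)) x = x"
  by (induction n) (simp_all add: assms funpow_add)

lemma funpow_commute: "(f ^^ m) ((f ^^ n) x) = (f ^^ n) ((f ^^ m) x)"
  by (metis add.commute comp_apply funpow_add)

text \<open>From left to right, a pigeonhole argument among the last iterates before x. Conversely,
  a periodic x has preimages of every order on its own finite cycle, and the matrix powers contract
  these to 0.\<close>

lemma zero_in_srs_tile_iff:
  fixes r :: "real ^ 'n::{finite,linorder}"
  assumes r: "r \<in> interior srs_periodic" and red: "r $ first_index \<noteq> 0"
  shows "0 \<in> srs_tile r x \<longleftrightarrow> (\<exists>m\<ge>1. (srs_map r ^^ m) x = x)"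
proof
  let ?M = "(*v) (companion_matrix r)" and ?T = "srs_map r"
  obtain \<rho> where \<rho>: "0 < \<rho>" "\<rho> < 1" "\<And>x. poly (srs_poly r) x = 0 \<Longrightarrow> norm x < \<rho>"
    using roots_in_smaller_disc[OF r] by blast
  {
    assume "0 \<in> srs_tile r x"
    then have small: "\<forall>\<^sub>F n in sequentially. \<exists>z. (?T ^^ n) z = x \<and> norm ((?M ^^ n) (real_vec z)) < \<epsilon>"
      if "\<epsilon> > 0" for \<epsilon>
      using that open_ball[of 0 \<epsilon>] unfolding srs_tile_def lower_Hausdorff_limit_def matrix_pow_vector
      by (auto elim!: allE[where x="ball 0 \<epsilon>"] eventually_mono)
    obtain C where C: "\<And>n z. norm (real_vec ((?T ^^ n) z)) \<le> norm ((?M ^^ n) (real_vec z)) + C"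
      using srs_orbit_bound[OF \<rho>] by blast
    \<comment> \<open>The summand 1 will bound the linear part of the iterates considered below, and
      C their accumulated rounding error.\<close>
    define B where "B = {y. norm (real_vec y :: real ^ 'n::_) \<le> 1 + C}"
    define k where "k = card B"
    have "finite B" unfolding B_def by (rule finite_lattice_ball)
    obtain b0 where b0: "b0 > 0" "\<And>v. b0 * norm v \<le> norm (?M v)"
      using linear_inj_bounded_below_pos[OF matrix_vector_mul_linear inj_companion_matrix[OF red]]
      by blast
    \<comment> \<open>Capped at 1 so that b^k \<le> b^j for j \<le> k.\<close>
    define b where "b = min b0 1"
    have b: "0 < b" "b \<le> 1" "b * norm v \<le> norm (?M v)" for v
    proof -
      show "b * norm v \<le> norm (?M v)"
        using b0(2)[of v] mult_right_mono[of b b0 "norm v"] by (simp add: b_def)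
    qed (use b0(1) in \<open>auto simp: b_def\<close>)
    have bpow: "b ^ j * norm v \<le> norm ((?M ^^ j) v)" for j v
    proof (induction j)
      case (Suc j)
      have "b ^ Suc j * norm v \<le> b * norm ((?M ^^ j) v)"
        using Suc b(1) by (simp add: mult.assoc)
      also have "\<dots> \<le> norm ((?M ^^ Suc j) v)" using b(3) by simp
      finally show ?case .
    qed simp
    \<comment> \<open>Undoing up to k matrix steps enlarges the norm by a factor of at most b^(-k),
      so starting below b^k keeps it below 1.\<close>
    have "\<forall>\<^sub>F n in sequentially. (\<exists>z. (?T ^^ n) z = x \<and> norm ((?M ^^ n) (real_vec z)) < b ^ k) \<and> k \<le> n"
      using small[of "b ^ k"] b(1) by (intro eventually_conj eventually_ge_at_top) auto
    then obtain n z where nz: "(?T ^^ n) z = x" "norm ((?M ^^ n) (real_vec z)) < b ^ k" "k \<le> n"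
      using eventually_happens' sequentially_bot by blast
    have image: "(?T ^^ j) ((?T ^^ (n - j)) z) = x" if "j \<le> k" for j
      using that nz(1,3) by (simp flip: funpow_add[THEN fun_cong, unfolded comp_apply])
    have "(?T ^^ (n - j)) z \<in> B" if "j \<le> k" for j
    proof -
      let ?v = "(?M ^^ (n - j)) (real_vec z)"
      have "b ^ j * norm ?v \<le> norm ((?M ^^ j) ?v)" by (rule bpow)
      also have "(?M ^^ j) ?v = (?M ^^ n) (real_vec z)"
        using that nz(3) by (simp flip: funpow_add[THEN fun_cong, unfolded comp_apply])
      also have "norm \<dots> < b ^ k" by fact
      also have "b ^ k \<le> b ^ j * 1"
        using that b by (simp add: power_decreasing)
      finally have "norm ?v < 1"
        using b(1) by (subst (asm) mult_less_cancel_left_pos) auto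
      then show ?thesis
        using C[of "n - j" z] unfolding B_def by simp
    qed
    \<comment> \<open>The k + 1 indices 0, ..., k are mapped into a set of k points.\<close>
    then have "\<not> inj_on (\<lambda>j. (?T ^^ (n - j)) z) {..k}"
      using \<open>finite B\<close> card_inj_on_le[of _ "{..k}" B] k_def by force
    then obtain i j where ij: "i < j" "j \<le> k" "(?T ^^ (n - i)) z = (?T ^^ (n - j)) z"
      unfolding inj_on_def by (metis atMost_iff linorder_neqE_nat)
    let ?y = "(?T ^^ (n - i)) z"
    \<comment> \<open>The coincidence makes \<open>?y\<close> periodic with period j - i, and its
      iterate x inherits the period.\<close>
    have "n - i = (j - i) + (n - j)" using ij nz(3) by simp
    then have "?y = (?T ^^ (j - i)) ((?T ^^ (n - j)) z)"
      by (simp add: funpow_add)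
    then have per: "(?T ^^ (j - i)) ?y = ?y" using ij(3) by simp
    have x: "x = (?T ^^ i) ?y" using image[of i] ij by simp
    have "(?T ^^ (j - i)) x = (?T ^^ i) ((?T ^^ (j - i)) ?y)"
      unfolding x by (rule funpow_commute)
    then have "(?T ^^ (j - i)) x = x" using per x by simp
    then show "\<exists>m\<ge>1. (?T ^^ m) x = x"
      using ij(1) by (intro exI[of _ "j - i"]) simp
  }
  {
    assume "\<exists>m\<ge>1. (?T ^^ m) x = x"
    then obtain m where m: "m \<ge> 1" "(?T ^^ m) x = x" by blast
    show "0 \<in> srs_tile r x"
      unfolding srs_tile_def lower_Hausdorff_limit_def mem_Collect_eq matrix_pow_vector
    proof (intro allI impI)
      fix U :: "(real ^ 'n::_) set" assume U: "open U \<and> 0 \<in> U"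
      have "\<forall>\<^sub>F n in sequentially. (?M ^^ n) v \<in> U" for v
      proof -
        obtain D where D: "\<And>n. norm ((?M ^^ n) v) \<le> D * \<rho> ^ n"
          using companion_matrix_orbit_bound[OF \<rho>] by blast
        have "(\<lambda>n. D * \<rho> ^ n) \<longlonglongrightarrow> 0"
          using \<rho>(1,2) by (intro tendsto_mult_right_zero LIMSEQ_realpow_zero) auto
        with always_eventually[OF allI[OF D]] have "(\<lambda>n. (?M ^^ n) v) \<longlonglongrightarrow> 0"
          by (rule Lim_null_comparison)
        then show ?thesis using U topological_tendstoD by blast
      qed
      \<comment> \<open>The cycle is finite, so pointwise convergence gives one threshold for all
        its points.\<close>
      then have "\<forall>\<^sub>F n in sequentially. \<forall>k\<in>{..<m}. (?M ^^ n) (real_vec ((?T ^^ k) x)) \<in> U"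
        by (intro eventually_ball_finite) auto
      then show "\<forall>\<^sub>F n in sequentially. U \<inter> (\<lambda>z. (?M ^^ n) (real_vec z)) ` {z. (?T ^^ n) z = x} \<noteq> {}"
      proof eventually_elim
        case (elim n)
        \<comment> \<open>Going back n steps on a cycle of length m is going forward (m - 1) n
          steps, as the two add up to m n. Reduction modulo m brings the exponent into the range
          covered by the threshold.\<close>
        let ?z = "(?T ^^ ((m - 1) * n mod m)) x"
        have "?z = (?T ^^ ((m - 1) * n)) x"
          by (rule funpow_mod_eq[OF m(2)])
        then have "(?T ^^ n) ?z = (?T ^^ (n + (m - 1) * n)) x"
          by (simp add: funpow_add)
        also have "n + (m - 1) * n = m * n"
          using m(1) by (cases m) auto
        finally have "(?T ^^ n) ?z = x"
          using funpow_mult_fixed[OF m(2)] by simp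
        moreover have "(?M ^^ n) (real_vec ?z) \<in> U"
          using elim m(1) by simp
        ultimately show ?case by blast
      qed
    qed
  }
qed

lemma srs_map_0: "srs_map r 0 = 0"
  by (simp add: vec_eq_iff srs_map_def real_vec_def inner_vec_def)

lemma srs_map_funpow_0: "(srs_map r ^^ n) 0 = 0"
  by (induction n) (simp_all add: srs_map_0)

text \<open>Every orbit ends in a cycle, and 0 is a fixed point: an orbit through 0 stays there, so
  a periodic point whose orbit meets 0 must be 0.\<close>

lemma srs_finite_iff_no_nonzero_periodic_point:
  assumes "r \<in> srs_periodic"
  shows "r \<in> srs_finite \<longleftrightarrow> (\<forall>x. \<forall>m\<ge>1. (srs_map r ^^ m) x = x \<longrightarrow> x = 0)"
proof
  assume fin: "r \<in> srs_finite"
  show "\<forall>x. \<forall>m\<ge>1. (srs_map r ^^ m) x = x \<longrightarrow> x = 0"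
  proof (intro allI impI)
    fix x m assume m: "(1::nat) \<le> m" "(srs_map r ^^ m) x = x"
    obtain n where n: "(srs_map r ^^ n) x = 0"
      using fin unfolding srs_finite_def by blast
    \<comment> \<open>At time m n the orbit is back at x, but it has stayed at 0 since time
      n.\<close>
    have "n \<le> m * n" using m(1) by simp
    then have "(srs_map r ^^ (m * n)) x = (srs_map r ^^ (m * n - n)) ((srs_map r ^^ n) x)"
      by (metis le_add_diff_inverse2 comp_apply funpow_add)
    then show "x = 0"
      using funpow_mult_fixed[OF m(2)] by (simp add: n srs_map_funpow_0)
  qed
next
  assume only0: "\<forall>x. \<forall>m\<ge>1. (srs_map r ^^ m) x = x \<longrightarrow> x = 0"
  have "\<exists>n. (srs_map r ^^ n) z = 0" for z
  proof -
    obtain m N where mN: "m \<ge> 1" "(srs_map r ^^ (N + m)) z = (srs_map r ^^ N) z"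
      using assms unfolding srs_periodic_def eventually_periodic_def by blast
    then have "(srs_map r ^^ m) ((srs_map r ^^ N) z) = (srs_map r ^^ N) z"
      by (simp add: add.commute[of N] funpow_add)
    with only0 mN(1) show ?thesis by blast
  qed
  then show "r \<in> srs_finite" by (simp add: srs_finite_def)
qed

theorem corollary3p11:
  fixes r :: "real ^ 'n::{finite,linorder}"
  assumes "r \<in> interior srs_periodic"
    and "r $ first_index \<noteq> 0"
  shows "r \<in> srs_finite \<longleftrightarrow> 0 \<in> srs_tile r 0 - (\<Union>y\<in>{y. y \<noteq> 0}. srs_tile r y)"
proof -
  have "r \<in> srs_periodic"
    using assms(1) interior_subset by blast
  \<comment> \<open>The fixed point 0 is purely periodic, so only the tiles of nonzero points
    decide.\<close>
  moreover have "0 \<in> srs_tile r 0"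
    unfolding zero_in_srs_tile_iff[OF assms] using srs_map_funpow_0 by blast
  ultimately show ?thesis
    using zero_in_srs_tile_iff[OF assms] srs_finite_iff_no_nonzero_periodic_point by auto
qed

end
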